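(* Let $J,K\subseteq\mathbb{R}$ be open intervals, and let $E$, $F$, $G$ be normalizable semideviations on the intervals $I:=J+K$, $J$, $K$, respectively, with normalizations $E^*,F^*,G^*$. Then the following assertions are equivalent: (i) for all $n\in\mathbb{N}$, $x\in J^n$, $y\in K^n$, $\lambda\in W_n(\mathbb{R})$: $\ \underline{\underline{\mathcal{D}}}_E(x+y,\lambda)\le\underline{\underline{\mathcal{D}}}_F(x,\lambda)+\underline{\underline{\mathcal{D}}}_G(y,\lambda)$; (ii) for all $n\in\mathbb{N}$, $x\in J^n$, $y\in K^n$, $\lambda\in W_n(\mathbb{R})$: $\ \underline{\mathcal{D}}_E(x+y,\lambda)\le\underline{\mathcal{D}}_F(x,\lambda)+\underline{\mathcal{D}}_G(y,\lambda)$; (iii) for all $n\in\mathbb{N}$, $x\in J^n$, $y\in K^n$, $\lambda\in W_n(\mathbb{R})$: $\ \overline{\mathcal{D}}_E(x+y,\lambda)\le\overline{\mathcal{D}}_F(x,\lambda)+\overline{\mathcal{D}}_G(y,\lambda)$; (iv) for all $n\in\mathbb{N}$, $x\in J^n$, $y\in K^n$, $\lambda\in W_n(\mathbb{R})$: $\ \overline{\overline{\mathcal{D}}}_E(x+y,\lambda)\le\overline{\overline{\mathcal{D}}}_F(x,\lambda)+\overline{\overline{\mathcal{D}}}_G(y,\lambda)$; (v) for all $n\in\mathbb{N}$, $x\in J^n$, $y\in K^n$, $\lambda\in W_n(\mathbb{R})$: $\ \underline{\underline{\mathcal{D}}}_E(x+y,\lambda)\le\overline{\overline{\mathcal{D}}}_F(x,\lambda)+\overline{\overline{\mathcal{D}}}_G(y,\lambda)$;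 (vi) for all $p,u\in J$ and $q,v\in K$: $\ E^*(p+q,u+v)\le F^*(p,u)+G^*(q,v)$.
   Context: $J+K=\{a+b\mid a\in J,\ b\in K\}$. For $n\in\mathbb{N}$, $W_n(\mathbb{R})=\{(\lambda_1,\dots,\lambda_n)\in\mathbb{R}^n\mid\lambda_i\ge0\ \forall i,\ \lambda_1+\dots+\lambda_n>0\}$. For an interval $I$, a function $E\colon I\times I\to\mathbb{R}$ is a semideviation on $I$ if for all distinct $x,y\in I$ the sign of $E(x,y)$ equals the sign of $x-y$. For $(x,\lambda)\in I^n\times W_n(\mathbb{R})$ let $e(y)=\lambda_1E(x_1,y)+\cdots+\lambda_nE(x_n,y)$, $y\in I$, and define $\underline{\underline{\mathcal{D}}}_E(x,\lambda)=\inf\{y\in I\mid e(y)\le0\}$, $\ \overline{\overline{\mathcal{D}}}_E(x,\lambda)=\sup\{y\in I\mid e(y)\ge0\}$, $\underline{\mathcal{D}}_E(x,\lambda)=\inf\{y\in I\mid e(y)<0\}$, $\ \overline{\mathcal{D}}_E(x,\lambda)=\sup\{y\in I\mid e(y)>0\}$. A semideviation $E\colon I\times I\to\mathbb{R}$ is normalizable if (a) for all $x\in I$ the function $y\mapsto E(x,y)$ is continuous on $I$; (b) for all $x\in I$ the function $y\mapsto E(x,y)$ is differentiable at $y=x$ (with derivative $\partial_2E(x,x)$); (c) $x\mapsto\partial_2E(x,x)$ is strictly negative and continuous on $I$. Its normalization is $E^*(x,y)=\dfrac{E(x,y)}{-\partial_2E(y,y)}$. *)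

theory Defs
  imports "HOL-Analysis.Analysis"
begin

text \<open>
  Functions \<open>I \<times> I \<rightarrow> \<real>\<close> are total curried functions whose values are only
  used on \<open>I\<close>. An \<open>n\<close>-tuple is a function on \<open>nat\<close> of which only the values on
  \<open>{1..n}\<close> are used, and \<open>J + K\<close> is the elementwise sum from \<open>Set_Algebras\<close>.
\<close>

text \<open>The set below is empty for \<open>n = 0\<close>, so that quantifying over all \<open>n\<close> and all
  weights in it is the same as quantifying over \<open>n \<ge> 1\<close>.\<close>

definition weights :: "nat \<Rightarrow> (nat \<Rightarrow> real) set" where
  "weights n = {l. (\<forall>i\<in>{1..n}. 0 \<le> l i) \<and> 0 < (\<Sum>i=1..n. l i)}"

definition semideviation :: "real set \<Rightarrow> (real \<Rightarrow> real \<Rightarrow> real) \<Rightarrow> bool" where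
  "semideviation I E \<longleftrightarrow> (\<forall>x\<in>I. \<forall>y\<in>I. x \<noteq> y \<longrightarrow> sgn (E x y) = sgn (x - y))"

definition weighted_sum ::
  "(real \<Rightarrow> real \<Rightarrow> real) \<Rightarrow> nat \<Rightarrow> (nat \<Rightarrow> real) \<Rightarrow> (nat \<Rightarrow> real) \<Rightarrow> real \<Rightarrow> real" where
  "weighted_sum E n x l y = (\<Sum>i=1..n. l i * E (x i) y)"

text \<open>
  The four semideviation means, in the order: doubly underlined, doubly overlined,
  underlined, overlined \<open>D\<close>. If \<open>I\<close> is an open interval, \<open>E\<close> a semideviation on \<open>I\<close>,
  \<open>x\<close> a tuple in \<open>I\<close> and \<open>l \<in> weights n\<close>, then \<open>weighted_sum E n x l\<close> is positive
  to the left and negative to the right of all the \<open>x i\<close>. Hence each infimum is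
  taken over a nonempty set bounded below and each supremum over a nonempty set
  bounded above, so that the real-valued \<open>Inf\<close> and \<open>Sup\<close> are the true ones.
\<close>

definition D_inf_le ::
  "real set \<Rightarrow> (real \<Rightarrow> real \<Rightarrow> real) \<Rightarrow> nat \<Rightarrow> (nat \<Rightarrow> real) \<Rightarrow> (nat \<Rightarrow> real) \<Rightarrow> real" where
  "D_inf_le I E n x l = Inf {y \<in> I. weighted_sum E n x l y \<le> 0}"

definition D_sup_ge ::
  "real set \<Rightarrow> (real \<Rightarrow> real \<Rightarrow> real) \<Rightarrow> nat \<Rightarrow> (nat \<Rightarrow> real) \<Rightarrow> (nat \<Rightarrow> real) \<Rightarrow> real" where
  "D_sup_ge I E n x l = Sup {y \<in> I. weighted_sum E n x l y \<ge> 0}"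

definition D_inf_less ::
  "real set \<Rightarrow> (real \<Rightarrow> real \<Rightarrow> real) \<Rightarrow> nat \<Rightarrow> (nat \<Rightarrow> real) \<Rightarrow> (nat \<Rightarrow> real) \<Rightarrow> real" where
  "D_inf_less I E n x l = Inf {y \<in> I. weighted_sum E n x l y < 0}"

definition D_sup_greater ::
  "real set \<Rightarrow> (real \<Rightarrow> real \<Rightarrow> real) \<Rightarrow> nat \<Rightarrow> (nat \<Rightarrow> real) \<Rightarrow> (nat \<Rightarrow> real) \<Rightarrow> real" where
  "D_sup_greater I E n x l = Sup {y \<in> I. weighted_sum E n x l y > 0}"

text \<open>\<open>\<partial>\<^sub>2E(x,x)\<close>, taken within \<open>I\<close> because \<open>E x\<close> is only meaningful there.\<close>

definition diag_deriv2 :: "real set \<Rightarrow> (real \<Rightarrow> real \<Rightarrow> real) \<Rightarrow> real \<Rightarrow> real" where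
  "diag_deriv2 I E x = vector_derivative (\<lambda>y. E x y) (at x within I)"

definition normalizable :: "real set \<Rightarrow> (real \<Rightarrow> real \<Rightarrow> real) \<Rightarrow> bool" where
  "normalizable I E \<longleftrightarrow>
     (\<forall>x\<in>I. continuous_on I (\<lambda>y. E x y)) \<and>
     (\<forall>x\<in>I. (\<lambda>y. E x y) differentiable (at x within I)) \<and>
     (\<forall>x\<in>I. diag_deriv2 I E x < 0) \<and>
     continuous_on I (diag_deriv2 I E)"

definition normalization ::
  "real set \<Rightarrow> (real \<Rightarrow> real \<Rightarrow> real) \<Rightarrow> real \<Rightarrow> real \<Rightarrow> real" where
  "normalization I E x y = E x y / (- diag_deriv2 I E y)"

end

theory Submission
  imports Defs
begin

text \<open>
  Summing the inequality for the normalizations with the given weights shows that if the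
  weighted sums of \<open>F\<close> at \<open>s\<close> and of \<open>G\<close> at \<open>t\<close> are both nonpositive (negative), then so is the
  one of \<open>E\<close> at \<open>s + t\<close>; this yields all four inequalities between equally decorated means. Each
  of these implies the mixed inequality, since every mean lies between the doubly underlined and
  the doubly overlined one. Finally, for the tuple \<open>(p, u)\<close> with weights \<open>(t, 1)\<close> any zero of the
  weighted sum of \<open>F\<close> is \<open>u + t F\<^sup>*(p, u) + o(t)\<close> as \<open>t\<close> tends to \<open>0\<close> from above, so the mixed
  inequality for \<open>(p, u)\<close> and \<open>(q, v)\<close> differentiates to the inequality for the normalizations.
\<close>

section \<open>Open intervals, their sums, and infima and suprema of subsets\<close>

lemma open_interval_set_plus:
  fixes J K :: "real set"
  assumes "open J" "is_interval J" "is_interval K"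
  shows "open (J + K)" "is_interval (J + K)"
proof -
  have "J + K = (\<Union>j\<in>J. \<Union>k\<in>K. {j + k})"
    by (auto simp: set_plus_def)
  then show "open (J + K)" using open_sums[of J K] assms(1) by simp
  show "is_interval (J + K)"
    using assms convex_set_plus by (auto simp: is_interval_convex_1)
qed

text \<open>The bound \<open>a\<close> must itself lie in \<open>I\<close>: this keeps the infimum
  from escaping to an endpoint of an open interval. It is caught between \<open>a\<close> and any
  element of \<open>A\<close>.\<close>

lemma cInf_mem_interval:
  fixes I :: "real set"
  assumes "is_interval I" "A \<subseteq> I" "A \<noteq> {}" "a \<in> I" "\<And>y. y \<in> A \<Longrightarrow> a \<le> y"
  shows "Inf A \<in> I"
proof -
  obtain y where y: "y \<in> A" using assms(3) by blast
  have "a \<le> Inf A" using assms by (intro cInf_greatest)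
  moreover have "Inf A \<le> y" using assms(5) y by (intro cInf_lower bdd_belowI)
  ultimately show ?thesis using mem_is_interval_1_I[OF assms(1,4)] y assms(2) by blast
qed

lemma cSup_mem_interval:
  fixes I :: "real set"
  assumes "is_interval I" "A \<subseteq> I" "A \<noteq> {}" "b \<in> I" "\<And>y. y \<in> A \<Longrightarrow> y \<le> b"
  shows "Sup A \<in> I"
proof -
  obtain y where y: "y \<in> A" using assms(3) by blast
  have "Sup A \<le> b" using assms by (intro cSup_least)
  moreover have "y \<le> Sup A" using assms(5) y by (intro cSup_upper bdd_aboveI)
  ultimately show ?thesis using mem_is_interval_1_I[OF assms(1) _ assms(4)] y assms(2) by blast
qed

lemma open_real_above:
  fixes x :: real
  assumes "open I" "x \<in> I" "x < y"
  obtains z where "z \<in> I" "x < z" "z < y"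
proof -
  obtain d where d: "d > 0" "ball x d \<subseteq> I" using assms open_contains_ball by metis
  let ?z = "x + min d (y - x) / 2"
  have "?z \<in> ball x d" using d assms by (auto simp: dist_real_def min_def)
  then have "?z \<in> I" using d by blast
  then show thesis by (rule that) (use d assms in \<open>auto simp: min_def field_simps\<close>)
qed

lemma open_real_below:
  fixes x :: real
  assumes "open I" "x \<in> I" "y < x"
  obtains z where "z \<in> I" "y < z" "z < x"
proof -
  obtain d where d: "d > 0" "ball x d \<subseteq> I" using assms open_contains_ball by metis
  let ?z = "x - min d (x - y) / 2"
  have "?z \<in> ball x d" using d assms by (auto simp: dist_real_def min_def)
  then have "?z \<in> I" using d by blast
  then show thesis by (rule that) (use d assms in \<open>auto simp: min_def field_simps\<close>)
qed

text \<open>Needed for the suprema: a point of \<open>J + K\<close> above the sum of two upper means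
  is split so that each summand lies strictly beyond its own mean, where the sign of its weighted
  sum is known. An arbitrary splitting \<open>w = a + b\<close> may have one summand too small; that
  one is raised slightly above its threshold, and the other is lowered accordingly.\<close>

lemma set_plus_split_above:
  fixes J K :: "real set"
  assumes J: "open J" "is_interval J" and K: "open K" "is_interval K"
    and uv: "u \<in> J" "v \<in> K" and w: "w \<in> J + K" "u + v < w"
  obtains s t where "s \<in> J" "t \<in> K" "u < s" "v < t" "w = s + t"
proof -
  \<comment> \<open>Stated for generic \<open>A\<close> and \<open>B\<close>, since it serves both
    orders of the summands. Choosing \<open>t\<close> between \<open>y\<close> and
    \<open>w - x\<close> puts \<open>w - t\<close> above \<open>x\<close>, while
    \<open>b \<le> y < t\<close> puts it below \<open>a\<close>; so it stays in the interval
    \<open>A\<close>.\<close>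
  have *: "\<exists>s t. s \<in> A \<and> t \<in> B \<and> x < s \<and> y < t \<and> w = s + t"
    if A: "is_interval A" and B: "open B" and xy: "x \<in> A" "y \<in> B" and ab: "a \<in> A" "w = a + b" "b \<le> y"
      and less: "x + y < w"
    for A B :: "real set" and x y a b
  proof -
    obtain t where t: "t \<in> B" "y < t" "t < w - x"
      using open_real_above[OF B xy(2), of "w - x"] less by auto
    have "w - t \<in> A"
      by (rule mem_is_interval_1_I[OF A xy(1) ab(1)]) (use t ab in auto)
    then show ?thesis using t by (intro exI[of _ "w - t"] exI[of _ t]) auto
  qed
  obtain a b where ab: "a \<in> J" "b \<in> K" "w = a + b"
    using w by (auto elim: set_plus_elim)
  consider "b \<le> v" | "a \<le> u" | "u < a" "v < b" by linarith
  then show thesis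
  proof cases
    case 1 then show thesis using *[OF J(2) K(1) uv ab(1,3)] w that by auto
  next
    case 2 then show thesis
      using *[OF K(2) J(1) uv(2,1) ab(2), of a] w ab(3) that by (auto simp: add.commute)
  next
    case 3 then show thesis using ab that by blast
  qed
qed

lemma le_cInf_add:
  fixes A B :: "real set"
  assumes "A \<noteq> {}" "B \<noteq> {}" "\<And>a b. a \<in> A \<Longrightarrow> b \<in> B \<Longrightarrow> c \<le> a + b"
  shows "c \<le> Inf A + Inf B"
proof -
  have "c - Inf A \<le> b" if "b \<in> B" for b
  proof -
    have "c - b \<le> Inf A" using assms that by (intro cInf_greatest) (auto simp: algebra_simps)
    then show ?thesis by simp
  qed
  then have "c - Inf A \<le> Inf B" using assms by (intro cInf_greatest)
  then show ?thesis by simp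
qed

section \<open>Signs of semideviations off and on the diagonal\<close>

lemma semideviation_pos:
  assumes "semideviation I E" "x \<in> I" "y \<in> I" "y < x"
  shows "0 < E x y"
  using assms unfolding semideviation_def by (metis diff_gt_0_iff_gt less_irrefl sgn_greater)

lemma semideviation_neg:
  assumes "semideviation I E" "x \<in> I" "y \<in> I" "x < y"
  shows "E x y < 0"
  using assms unfolding semideviation_def by (metis diff_less_0_iff_less less_irrefl sgn_less)

text \<open>The definition leaves the diagonal free. As \<open>x\<close> is interior, it can be
  approached from both sides: positive values on the left and negative ones on the right leave only
  0 as the continuous value.\<close>

lemma semideviation_diag:
  assumes I: "open I" "x \<in> I" and sd: "semideviation I E" and cont: "continuous_on I (E x)"
  shows "E x x = 0"
proof -
  have lim: "(E x \<longlongrightarrow> E x x) (at x)"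
    using cont I by (simp add: continuous_on_eq_continuous_at isCont_def)
  have ev: "\<forall>\<^sub>F y in nhds x. y \<in> I" using I by (rule eventually_nhds_in_open)
  have "0 \<le> E x x"
  proof (rule tendsto_lowerbound)
    show "(E x \<longlongrightarrow> E x x) (at_left x)"
      using lim by (rule filterlim_mono) (auto intro: at_le)
    show "\<forall>\<^sub>F y in at_left x. 0 \<le> E x y"
      using ev unfolding eventually_at_filter
      by eventually_elim (use semideviation_pos[OF sd I(2)] in \<open>auto intro: less_imp_le\<close>)
  qed simp
  moreover have "E x x \<le> 0"
  proof (rule tendsto_upperbound)
    show "(E x \<longlongrightarrow> E x x) (at_right x)"
      using lim by (rule filterlim_mono) (auto intro: at_le)
    show "\<forall>\<^sub>F y in at_right x. E x y \<le> 0"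
      using ev unfolding eventually_at_filter
      by eventually_elim (use semideviation_neg[OF sd I(2)] in \<open>auto intro: less_imp_le\<close>)
  qed simp
  ultimately show ?thesis by simp
qed

section \<open>The four means of one weighted tuple\<close>

locale semideviation_mean =
  fixes I :: "real set" and E :: "real \<Rightarrow> real \<Rightarrow> real" and n :: nat and x l :: "nat \<Rightarrow> real"
  assumes open_I: "open I" and interval_I: "is_interval I" and sd: "semideviation I E"
    and x: "x \<in> {1..n} \<rightarrow> I" and l: "l \<in> weights n"
begin

abbreviation e :: "real \<Rightarrow> real" where "e \<equiv> weighted_sum E n x l"

lemma x_mem: "i \<in> {1..n} \<Longrightarrow> x i \<in> I"
  using x by (rule PiE) auto

text \<open>Individual weights may vanish, so the strict sign of a weighted sum comes from a single
  positive weight, the other terms having only a weak sign.\<close>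

lemma weight_pos: obtains i where "i \<in> {1..n}" "0 < l i"
proof -
  have "\<exists>i\<in>{1..n}. 0 < l i"
  proof (rule ccontr)
    assume "\<not> ?thesis"
    then have "(\<Sum>i=1..n. l i) \<le> 0" by (intro sum_nonpos) (auto simp: not_less)
    then show False using l by (simp add: weights_def)
  qed
  then show thesis using that by blast
qed

lemma e_pos:
  assumes "y \<in> I" "\<And>i. i \<in> {1..n} \<Longrightarrow> y < x i"
  shows "0 < e y"
proof -
  obtain j where j: "j \<in> {1..n}" "0 < l j" by (rule weight_pos)
  have E: "0 < E (x i) y" if "i \<in> {1..n}" for i
    using semideviation_pos[OF sd, of "x i" y] assms x_mem[OF that] that by blast
  show ?thesis
    unfolding weighted_sum_def
    by (rule sum_pos2[OF _ j(1)]) (use j E l in \<open>auto simp: weights_def less_imp_le\<close>)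
qed

lemma e_neg:
  assumes "y \<in> I" "\<And>i. i \<in> {1..n} \<Longrightarrow> x i < y"
  shows "e y < 0"
proof -
  obtain j where j: "j \<in> {1..n}" "0 < l j" by (rule weight_pos)
  have E: "E (x i) y < 0" if "i \<in> {1..n}" for i
    using semideviation_neg[OF sd, of "x i" y] assms x_mem[OF that] that by blast
  have "0 < (\<Sum>i=1..n. l i * (- E (x i) y))"
    by (rule sum_pos2[OF _ j(1)]) (use j E l in \<open>auto simp: weights_def less_imp_le mult_less_0_iff mult_le_0_iff\<close>)
  then show ?thesis by (simp add: weighted_sum_def sum_negf)
qed

text \<open>Openness provides \<open>a\<close> in \<open>I\<close> below all \<open>x i\<close> and
  \<open>b\<close> in \<open>I\<close> above all of them. These two points witness that the sets
  defining the means are nonempty, bounded, and bounded by elements of \<open>I\<close>, so that the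
  means exist and lie in \<open>I\<close>.\<close>

lemma sign_bounds:
  obtains a b where "a \<in> I" "b \<in> I" "e a > 0" "e b < 0"
    "\<forall>y\<in>I. e y \<le> 0 \<longrightarrow> a \<le> y" "\<forall>y\<in>I. 0 \<le> e y \<longrightarrow> y \<le> b"
proof -
  have ne: "x ` {1..n} \<noteq> {}" using weight_pos by blast
  have "Min (x ` {1..n}) \<in> x ` {1..n}" "Max (x ` {1..n}) \<in> x ` {1..n}"
    using ne by (intro Min_in Max_in; simp)+
  then have mm: "Min (x ` {1..n}) \<in> I" "Max (x ` {1..n}) \<in> I"
    using x_mem by (metis imageE)+
  obtain a' b' where "a' < Min (x ` {1..n})" "Max (x ` {1..n}) < b'"
    using lt_ex gt_ex by metis
  with mm obtain a b where a: "a \<in> I" "a < Min (x ` {1..n})" and b: "b \<in> I" "Max (x ` {1..n}) < b"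
    using open_real_below[OF open_I] open_real_above[OF open_I] by metis
  have ax: "a < x i" and xb: "x i < b" if "i \<in> {1..n}" for i
    using a b that Min_le[of "x ` {1..n}" "x i"] Max_ge[of "x ` {1..n}" "x i"] by force+
  have "a \<le> y" if "y \<in> I" "e y \<le> 0" for y
    using e_pos[OF that(1)] that(2) ax by force
  moreover have "y \<le> b" if "y \<in> I" "0 \<le> e y" for y
    using e_neg[OF that(1)] that(2) xb by force
  ultimately show thesis using that[of a b] a b e_pos e_neg ax xb by blast
qed

lemma nonempty: "{y \<in> I. e y < 0} \<noteq> {}" "{y \<in> I. e y \<le> 0} \<noteq> {}"
    "{y \<in> I. e y > 0} \<noteq> {}" "{y \<in> I. e y \<ge> 0} \<noteq> {}"
proof -
  obtain a b where ab: "a \<in> I" "b \<in> I" "e a > 0" "e b < 0"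
    "\<forall>y\<in>I. e y \<le> 0 \<longrightarrow> a \<le> y" "\<forall>y\<in>I. 0 \<le> e y \<longrightarrow> y \<le> b"
    using sign_bounds by blast
  show "{y \<in> I. e y < 0} \<noteq> {}" "{y \<in> I. e y \<le> 0} \<noteq> {}"
    "{y \<in> I. e y > 0} \<noteq> {}" "{y \<in> I. e y \<ge> 0} \<noteq> {}"
    using ab(1-4) by (auto intro: less_imp_le)
qed

lemma bdd: "bdd_below {y \<in> I. e y < 0}" "bdd_below {y \<in> I. e y \<le> 0}"
    "bdd_above {y \<in> I. e y > 0}" "bdd_above {y \<in> I. e y \<ge> 0}"
proof -
  obtain a b where ab: "a \<in> I" "b \<in> I" "e a > 0" "e b < 0"
    "\<forall>y\<in>I. e y \<le> 0 \<longrightarrow> a \<le> y" "\<forall>y\<in>I. 0 \<le> e y \<longrightarrow> y \<le> b"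
    using sign_bounds by blast
  show *: "bdd_below {y \<in> I. e y \<le> 0}" "bdd_above {y \<in> I. e y \<ge> 0}"
    using ab(5,6) by (auto intro!: bdd_belowI[where m = a] bdd_aboveI[where M = b])
  show "bdd_below {y \<in> I. e y < 0}"
    by (rule bdd_below_mono[OF *(1)]) auto
  show "bdd_above {y \<in> I. e y > 0}"
    by (rule bdd_above_mono[OF *(2)]) auto
qed

lemma D_mem: "D_inf_less I E n x l \<in> I" "D_inf_le I E n x l \<in> I"
    "D_sup_greater I E n x l \<in> I" "D_sup_ge I E n x l \<in> I"
proof -
  obtain a b where ab: "a \<in> I" "b \<in> I" "e a > 0" "e b < 0"
    "\<forall>y\<in>I. e y \<le> 0 \<longrightarrow> a \<le> y" "\<forall>y\<in>I. 0 \<le> e y \<longrightarrow> y \<le> b"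
    using sign_bounds by blast
  show "D_inf_less I E n x l \<in> I"
    unfolding D_inf_less_def
    by (rule cInf_mem_interval[OF interval_I _ nonempty(1) ab(1)]) (use ab(5) in auto)
  show "D_inf_le I E n x l \<in> I"
    unfolding D_inf_le_def
    by (rule cInf_mem_interval[OF interval_I _ nonempty(2) ab(1)]) (use ab(5) in auto)
  show "D_sup_greater I E n x l \<in> I"
    unfolding D_sup_greater_def
    by (rule cSup_mem_interval[OF interval_I _ nonempty(3) ab(2)]) (use ab(6) in auto)
  show "D_sup_ge I E n x l \<in> I"
    unfolding D_sup_ge_def
    by (rule cSup_mem_interval[OF interval_I _ nonempty(4) ab(2)]) (use ab(6) in auto)
qed

lemma D_inf_le_least: "y \<in> I \<Longrightarrow> e y \<le> 0 \<Longrightarrow> D_inf_le I E n x l \<le> y"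
  unfolding D_inf_le_def by (rule cInf_lower[OF _ bdd(2)]) simp

lemma D_inf_less_least: "y \<in> I \<Longrightarrow> e y < 0 \<Longrightarrow> D_inf_less I E n x l \<le> y"
  unfolding D_inf_less_def by (rule cInf_lower[OF _ bdd(1)]) simp

lemma D_sup_ge_greatest: "y \<in> I \<Longrightarrow> 0 \<le> e y \<Longrightarrow> y \<le> D_sup_ge I E n x l"
  unfolding D_sup_ge_def by (rule cSup_upper[OF _ bdd(4)]) simp

lemma D_sup_greater_greatest: "y \<in> I \<Longrightarrow> 0 < e y \<Longrightarrow> y \<le> D_sup_greater I E n x l"
  unfolding D_sup_greater_def by (rule cSup_upper[OF _ bdd(3)]) simp

lemma D_inf_le_le_D_inf_less: "D_inf_le I E n x l \<le> D_inf_less I E n x l"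
  unfolding D_inf_le_def D_inf_less_def by (rule cInf_superset_mono[OF nonempty(1) bdd(2)]) auto

lemma D_sup_greater_le_D_sup_ge: "D_sup_greater I E n x l \<le> D_sup_ge I E n x l"
  unfolding D_sup_greater_def D_sup_ge_def by (rule cSup_subset_mono[OF nonempty(3) bdd(4)]) auto

text \<open>If the order were reversed, a point of \<open>I\<close> strictly between the two means
  would have a weighted sum that is positive (below the infimum) and nonpositive (above the
  supremum). The next lemma uses the same argument with the strictness exchanged.\<close>

lemma D_inf_le_le_D_sup_greater: "D_inf_le I E n x l \<le> D_sup_greater I E n x l"
proof (rule ccontr)
  assume "\<not> ?thesis"
  then obtain y where y: "y \<in> I" "D_sup_greater I E n x l < y" "y < D_inf_le I E n x l"
    using open_real_below[OF open_I D_mem(2)] by (metis not_le)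
  then show False using D_inf_le_least[of y] D_sup_greater_greatest[of y] by linarith
qed

lemma D_inf_less_le_D_sup_ge: "D_inf_less I E n x l \<le> D_sup_ge I E n x l"
proof (rule ccontr)
  assume "\<not> ?thesis"
  then obtain y where y: "y \<in> I" "D_sup_ge I E n x l < y" "y < D_inf_less I E n x l"
    using open_real_below[OF open_I D_mem(1)] by (metis not_le)
  then show False using D_inf_less_least[of y] D_sup_ge_greatest[of y] by linarith
qed

text \<open>By continuity a nonzero sign persists on a neighbourhood in \<open>I\<close>, and then
  the infimum or supremum could be moved. The zeros are what the asymptotic analysis of the means
  starts from.\<close>

lemma zeros_at_extreme_means:
  assumes cont: "\<And>z. z \<in> I \<Longrightarrow> continuous_on I (E z)"
  shows "e (D_inf_le I E n x l) = 0" "e (D_sup_ge I E n x l) = 0"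
proof -
  have "continuous_on I e"
    unfolding weighted_sum_def using x by (intro continuous_intros cont) auto
  then have ce: "isCont e y" if "y \<in> I" for y
    using that open_I by (simp add: continuous_on_eq_continuous_at)
  have nbhd: "\<exists>d>0. \<forall>y. \<bar>y - z\<bar> < d \<longrightarrow> y \<in> I \<and> sgn (e y) = sgn (e z)" if z: "z \<in> I" "e z \<noteq> 0" for z
  proof -
    \<comment> \<open>Multiplying by \<open>sgn (e z)\<close> treats both signs at once: the limit
      is \<open>\<bar>e z\<bar>\<close>.\<close>
    have "\<forall>\<^sub>F y in nhds z. 0 < e y * sgn (e z)"
    proof (rule order_tendstoD(1))
      show "((\<lambda>y. e y * sgn (e z)) \<longlongrightarrow> e z * sgn (e z)) (nhds z)"
        using ce[OF z(1)] by (intro tendsto_intros) (simp add: isCont_def tendsto_at_iff_tendsto_nhds)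
      show "0 < e z * sgn (e z)" using z by (simp flip: abs_sgn)
    qed
    then have "\<forall>\<^sub>F y in nhds z. y \<in> I \<and> sgn (e y) = sgn (e z)"
      using eventually_nhds_in_open[OF open_I z(1)]
      by eventually_elim (use z in \<open>auto simp: sgn_if zero_less_mult_iff split: if_splits\<close>)
    then show ?thesis by (auto simp: eventually_nhds_metric dist_real_def)
  qed
  let ?m = "D_inf_le I E n x l" and ?M = "D_sup_ge I E n x l"
  show "e ?m = 0"
  proof (rule ccontr)
    assume "e ?m \<noteq> 0"
    from nbhd[OF D_mem(2) this] obtain d
      where d: "d > 0" "\<And>y. \<bar>y - ?m\<bar> < d \<Longrightarrow> y \<in> I \<and> sgn (e y) = sgn (e ?m)" by blast
    show False
    \<comment> \<open>A negative value would put \<open>?m - d/2\<close> into the set, below its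
      infimum. A positive value would exclude every point within \<open>d\<close> of
      \<open>?m\<close>, making \<open>?m + d\<close> a lower bound. The supremum is treated
      symmetrically.\<close>
    proof (cases "e ?m < 0")
      case True
      then show False using d(1) D_inf_le_least[of "?m - d/2"] d(2)[of "?m - d/2"]
        by (auto simp: sgn_if split: if_splits)
    next
      case False
      have "?m + d \<le> y" if "y \<in> I" "e y \<le> 0" for y
        using D_inf_le_least[OF that] d(2)[of y] that False \<open>e ?m \<noteq> 0\<close>
        by (force simp: sgn_if split: if_splits)
      then have "?m + d \<le> ?m"
        using nonempty by (subst (2) D_inf_le_def) (intro cInf_greatest; auto)
      then show False using d by simp
    qed
  qed
  show "e ?M = 0"
  proof (rule ccontr)
    assume "e ?M \<noteq> 0"
    from nbhd[OF D_mem(4) this] obtain d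
      where d: "d > 0" "\<And>y. \<bar>y - ?M\<bar> < d \<Longrightarrow> y \<in> I \<and> sgn (e y) = sgn (e ?M)" by blast
    show False
    proof (cases "e ?M > 0")
      case True
      then show False using d(1) D_sup_ge_greatest[of "?M + d/2"] d(2)[of "?M + d/2"]
        by (auto simp: sgn_if split: if_splits)
    next
      case False
      have "y \<le> ?M - d" if "y \<in> I" "0 \<le> e y" for y
        using D_sup_ge_greatest[OF that] d(2)[of y] that False \<open>e ?M \<noteq> 0\<close>
        by (force simp: sgn_if split: if_splits)
      then have "?M \<le> ?M - d"
        using nonempty by (subst D_sup_ge_def) (intro cSup_least; auto)
      then show False using d by simp
    qed
  qed
qed

end

section \<open>First-order behaviour of zeros under a small weight\<close>

lemma normalizableD:
  assumes "open I" "normalizable I E" "u \<in> I"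
  shows "continuous_on I (E u)" "diag_deriv2 I E u < 0"
    "(E u has_real_derivative diag_deriv2 I E u) (at u)"
proof -
  show "continuous_on I (E u)" "diag_deriv2 I E u < 0"
    using assms by (auto simp: normalizable_def)
  have "E u differentiable (at u)"
    using assms by (auto simp: normalizable_def at_within_open[OF assms(3,1)])
  then show "(E u has_real_derivative diag_deriv2 I E u) (at u)"
    unfolding diag_deriv2_def at_within_open[OF assms(3,1)]
    by (simp add: has_real_derivative_iff_has_vector_derivative vector_derivative_works)
qed

text \<open>Dividing the equation for \<open>D t\<close> by the difference quotient of
  \<open>E u\<close> at \<open>u\<close> gives \<open>(D t - u) / t = E p (D t) / - ((E u (D t) - E
  u u) / (D t - u))\<close> when \<open>p \<noteq> u\<close>. Once \<open>D t\<close> is known to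
  tend to \<open>u\<close>, the right side tends to the normalization. The zero need not be unique,
  so any choice \<open>D\<close> is allowed.\<close>

lemma perturbed_zero_asymptotics:
  assumes I: "open I" "is_interval I" and sd: "semideviation I E" and nm: "normalizable I E"
    and pu: "p \<in> I" "u \<in> I"
    and D: "\<And>t. 0 < t \<Longrightarrow> D t \<in> I" "\<And>t. 0 < t \<Longrightarrow> t * E p (D t) + E u (D t) = 0"
  shows "((\<lambda>t. (D t - u) / t) \<longlongrightarrow> normalization I E p u) (at_right 0)"
proof -
  note cont = normalizableD(1)[OF I(1) nm]
  note deriv = normalizableD(2,3)[OF I(1) nm pu(2)]
  have diag: "E z z = 0" if "z \<in> I" for z
    by (rule semideviation_diag[OF I(1) that sd cont[OF that]])
  have E_ne_0: "E z y \<noteq> 0" if "z \<in> I" "y \<in> I" "y \<noteq> z" for y z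
    using semideviation_pos[OF sd that(1,2)] semideviation_neg[OF sd that(1,2)] that(3)
    by (cases "y < z") auto
  have pos: "\<forall>\<^sub>F t in at_right 0. 0 < (t::real)" by (rule eventually_at_right_less)
  show ?thesis
  proof (cases "p = u")
    case True
    \<comment> \<open>For \<open>p = u\<close> the equation is
      \<open>(t + 1) * E u (D t) = 0\<close>, which forces \<open>D t = u\<close>; both sides of the
      limit are then 0.\<close>
    have D_eq: "D t = u" if "0 < t" for t
    proof (rule ccontr)
      assume "D t \<noteq> u"
      then have "E u (D t) \<noteq> 0" using E_ne_0 pu D(1)[OF that] by blast
      moreover have "(t + 1) * E u (D t) = 0" using D(2)[OF that] True by (simp add: algebra_simps)
      ultimately show False using that by auto
    qed
    have "\<forall>\<^sub>F t in at_right 0. (D t - u) / t = normalization I E p u"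
      using pos by eventually_elim (simp add: D_eq True normalization_def diag pu)
    then show ?thesis by (rule tendsto_eventually)
  next
    case False
    \<comment> \<open>Outside the segment between \<open>p\<close> and \<open>u\<close> both terms
      of the equation have the same strict sign, so every zero lies in this compact subset of
      \<open>I\<close>, on which \<open>E p\<close> is bounded.\<close>
    define S where "S = closed_segment p u"
    have S: "compact S" "S \<subseteq> I"
      using I pu by (auto simp: S_def is_interval_convex_1 closed_segment_subset)
    have D_ne: "D t \<noteq> u" if "0 < t" for t
      using D(2)[OF that] E_ne_0[OF pu] diag[OF pu(2)] False that by auto
    have D_S: "D t \<in> S" if "0 < t" for t
    proof (rule ccontr)
      assume "D t \<notin> S"
      then consider "D t < p" "D t < u" | "p < D t" "u < D t"
        by (auto simp: S_def closed_segment_eq_real_ivl split: if_splits)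
      then show False
      proof cases
        case 1
        then have "0 < E p (D t)" "0 < E u (D t)"
          using semideviation_pos[OF sd _ D(1)[OF that]] pu by auto
        then show False using D(2)[OF that] mult_pos_pos[OF that] by force
      next
        case 2
        then have "E p (D t) < 0" "E u (D t) < 0"
          using semideviation_neg[OF sd _ D(1)[OF that]] pu by auto
        then show False using D(2)[OF that] mult_pos_neg[OF that] by force
      qed
    qed
    have "bounded (E p ` S)"
      by (intro compact_imp_bounded compact_continuous_image continuous_on_subset[OF cont] S pu)
    then obtain M where M: "M > 0" "\<And>y. y \<in> S \<Longrightarrow> \<bar>E p y\<bar> \<le> M"
      by (auto simp: bounded_pos)
    have D_lim: "(D \<longlongrightarrow> u) (at_right 0)"
    proof (rule tendstoI)
      fix r :: real assume "0 < r"
      \<comment> \<open>On the part of \<open>S\<close> at distance at least \<open>r\<close> from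
        \<open>u\<close>, \<open>\<bar>E u y\<bar>\<close> has a positive minimum
        \<open>\<bar>E u m\<bar>\<close>. The equation bounds \<open>\<bar>E u (D t)\<bar>\<close>
        by \<open>t * M\<close>, so \<open>D t\<close> leaves \<open>T\<close> as soon as
        \<open>t < \<bar>E u m\<bar> / M\<close>.\<close>
      define T where "T = S - ball u r"
      have T: "compact T" "T \<subseteq> I" using S by (auto simp: T_def compact_diff)
      show "\<forall>\<^sub>F t in at_right 0. dist (D t) u < r"
      proof (cases "T = {}")
        case True
        have "dist (D t) u < r" if "0 < t" for t
          using D_S[OF that] True by (auto simp: T_def dist_commute)
        with pos show ?thesis by (rule eventually_mono)
      next
        case False
        have "continuous_on T (\<lambda>y. \<bar>E u y\<bar>)"
          by (intro continuous_intros continuous_on_subset[OF cont] T pu)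
        from continuous_attains_inf[OF T(1) False this] obtain m
          where m: "m \<in> T" "\<And>y. y \<in> T \<Longrightarrow> \<bar>E u m\<bar> \<le> \<bar>E u y\<bar>" by blast
        have "m \<noteq> u" using m(1) \<open>0 < r\<close> by (auto simp: T_def)
        then have "0 < \<bar>E u m\<bar> / M" using E_ne_0[OF pu(2), of m] m(1) T(2) M(1) by auto
        from eventually_at_right_real[OF this] show ?thesis
        proof eventually_elim
          case (elim t)
          then have t: "0 < t" "t * M < \<bar>E u m\<bar>" using M(1) by (auto simp: field_simps)
          show ?case
          proof (rule ccontr)
            assume "\<not> ?case"
            then have "D t \<in> T" using D_S[OF t(1)] by (auto simp: T_def dist_commute)
            then have "\<bar>E u m\<bar> \<le> \<bar>E u (D t)\<bar>" by (rule m)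
            also have "E u (D t) = - (t * E p (D t))" using D(2)[OF t(1)] by simp
            also have "\<bar>\<dots>\<bar> = t * \<bar>E p (D t)\<bar>" using t(1) by (simp add: abs_mult)
            also have "\<dots> \<le> t * M" using M(2)[OF D_S[OF t(1)]] t(1) by simp
            finally show False using t(2) by simp
          qed
        qed
      qed
    qed
    \<comment> \<open>The difference quotient has a limit only along the punctured filter
      \<open>at u\<close>, so \<open>D t\<close> must avoid \<open>u\<close>.\<close>
    have "\<forall>\<^sub>F t in at_right 0. D t \<noteq> u"
      using pos by eventually_elim (rule D_ne)
    with D_lim have D_at: "filterlim D (at u) (at_right 0)" by (rule filterlim_atI)
    have "((\<lambda>y. (E u y - E u u) / (y - u)) \<longlongrightarrow> diag_deriv2 I E u) (at u)"
      using deriv(2) by (simp add: has_field_derivative_iff)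
    then have slope: "((\<lambda>t. (E u (D t) - E u u) / (D t - u)) \<longlongrightarrow> diag_deriv2 I E u) (at_right 0)"
      using D_at by (rule filterlim_compose)
    have "isCont (E p) u" using cont[OF pu(1)] pu(2) I(1) by (simp add: continuous_on_eq_continuous_at)
    then have "((\<lambda>t. E p (D t)) \<longlongrightarrow> E p u) (at_right 0)"
      using D_lim by (rule isCont_tendsto_compose)
    then have "((\<lambda>t. E p (D t) / - ((E u (D t) - E u u) / (D t - u))) \<longlongrightarrow> normalization I E p u) (at_right 0)"
      unfolding normalization_def using deriv(1) by (intro tendsto_intros slope) auto
    moreover have "\<forall>\<^sub>F t in at_right 0. E p (D t) / - ((E u (D t) - E u u) / (D t - u)) = (D t - u) / t"
      using pos
    proof eventually_elim
      case (elim t)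
      have "E u (D t) \<noteq> 0" using E_ne_0[OF pu(2) D(1)] D_ne elim by blast
      moreover have eq: "E u (D t) = - (t * E p (D t))" using D(2)[OF elim] by simp
      ultimately have "E p (D t) \<noteq> 0" by auto
      then show ?case using elim D_ne[OF elim] by (simp add: diag[OF pu(2)] eq)
    qed
    ultimately show ?thesis by (rule Lim_transform_eventually)
  qed
qed

section \<open>Equivalence of the inequalities for means and for normalizations\<close>

locale semideviation_triple =
  fixes J K :: "real set" and E F G :: "real \<Rightarrow> real \<Rightarrow> real"
  assumes J: "open J" "is_interval J" and K: "open K" "is_interval K"
    and E: "semideviation (J + K) E" "normalizable (J + K) E"
    and F: "semideviation J F" "normalizable J F"
    and G: "semideviation K G" "normalizable K G"
begin

text \<open>Separate parameters for the two sides let the mixed inequality be expressed as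
  well.\<close>

abbreviation means_ineq where
  "means_ineq A B \<equiv> \<forall>n. \<forall>x\<in>{1..n} \<rightarrow> J. \<forall>y\<in>{1..n} \<rightarrow> K. \<forall>l\<in>weights n.
     A (J + K) E n (\<lambda>i. x i + y i) l \<le> B J F n x l + B K G n y l"

abbreviation normalization_ineq where
  "normalization_ineq \<equiv> \<forall>p\<in>J. \<forall>u\<in>J. \<forall>q\<in>K. \<forall>v\<in>K.
     normalization (J + K) E (p + q) (u + v) \<le> normalization J F p u + normalization K G q v"

lemmas JK = open_interval_set_plus[OF J K(2)]

lemma semideviation_means:
  assumes "x \<in> {1..n} \<rightarrow> J" "y \<in> {1..n} \<rightarrow> K" "l \<in> weights n"
  shows "semideviation_mean (J + K) E n (\<lambda>i. x i + y i) l"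
    "semideviation_mean J F n x l" "semideviation_mean K G n y l"
  using assms J K JK E F G by (unfold_locales; force intro: set_plus_intro)+

text \<open>The denominator of a normalization depends on its second argument only, so it is common
  to all terms and can be pulled out of the weighted sum.\<close>

lemma weighted_sum_le:
  assumes N: "normalization_ineq" and xyl: "x \<in> {1..n} \<rightarrow> J" "y \<in> {1..n} \<rightarrow> K" "l \<in> weights n"
    and st: "s \<in> J" "t \<in> K"
  shows "weighted_sum E n (\<lambda>i. x i + y i) l (s + t) / - diag_deriv2 (J + K) E (s + t)
    \<le> weighted_sum F n x l s / - diag_deriv2 J F s + weighted_sum G n y l t / - diag_deriv2 K G t"
proof -
  have "l i * normalization (J + K) E (x i + y i) (s + t)
      \<le> l i * (normalization J F (x i) s + normalization K G (y i) t)" if "i \<in> {1..n}" for i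
    using N xyl st that by (intro mult_left_mono) (auto simp: weights_def Pi_iff)
  then have "(\<Sum>i=1..n. l i * normalization (J + K) E (x i + y i) (s + t))
      \<le> (\<Sum>i=1..n. l i * (normalization J F (x i) s + normalization K G (y i) t))"
    by (rule sum_mono)
  then show ?thesis
    unfolding weighted_sum_def normalization_def sum_divide_distrib
    by (simp only: distrib_left sum.distrib times_divide_eq_right)
qed

lemma weighted_sum_sign:
  assumes "normalization_ineq" "x \<in> {1..n} \<rightarrow> J" "y \<in> {1..n} \<rightarrow> K" "l \<in> weights n" "s \<in> J" "t \<in> K"
  shows "weighted_sum F n x l s \<le> 0 \<Longrightarrow> weighted_sum G n y l t \<le> 0
      \<Longrightarrow> weighted_sum E n (\<lambda>i. x i + y i) l (s + t) \<le> 0"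
    and "weighted_sum F n x l s < 0 \<Longrightarrow> weighted_sum G n y l t < 0
      \<Longrightarrow> weighted_sum E n (\<lambda>i. x i + y i) l (s + t) < 0"
proof -
  define a b c where abc: "a = - diag_deriv2 (J + K) E (s + t)" "b = - diag_deriv2 J F s" "c = - diag_deriv2 K G t"
  have pos: "0 < a" "0 < b" "0 < c"
    unfolding abc using normalizableD(2)[OF JK(1) E(2) set_plus_intro[OF assms(5,6)]]
      normalizableD(2)[OF J(1) F(2) assms(5)] normalizableD(2)[OF K(1) G(2) assms(6)] by auto
  note le = weighted_sum_le[OF assms, folded abc]
  show "weighted_sum E n (\<lambda>i. x i + y i) l (s + t) \<le> 0"
    if "weighted_sum F n x l s \<le> 0" "weighted_sum G n y l t \<le> 0"
  proof -
    have "weighted_sum F n x l s / b \<le> 0" "weighted_sum G n y l t / c \<le> 0"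
      using that pos by (auto simp: divide_le_0_iff)
    with le have "weighted_sum E n (\<lambda>i. x i + y i) l (s + t) / a \<le> 0" by linarith
    then show ?thesis using pos by (simp add: divide_le_0_iff)
  qed
  show "weighted_sum E n (\<lambda>i. x i + y i) l (s + t) < 0"
    if "weighted_sum F n x l s < 0" "weighted_sum G n y l t < 0"
  proof -
    have "weighted_sum F n x l s / b < 0" "weighted_sum G n y l t / c < 0"
      using that pos by (auto simp: divide_less_0_iff)
    with le have "weighted_sum E n (\<lambda>i. x i + y i) l (s + t) / a < 0" by linarith
    then show ?thesis using pos by (simp add: divide_less_0_iff)
  qed
qed

text \<open>For the infima, sums of elements of the sets for \<open>F\<close> and \<open>G\<close>
  lie in the set for \<open>E\<close>. For the suprema one argues by contradiction: a point of the
  set for \<open>E\<close> above the sum of the means splits into points beyond the means of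
  \<open>F\<close> and \<open>G\<close>, where the sign transfer contradicts membership.\<close>

lemma means_le_if_normalization_ineq:
  assumes N: "normalization_ineq" and xyl: "x \<in> {1..n} \<rightarrow> J" "y \<in> {1..n} \<rightarrow> K" "l \<in> weights n"
  shows "D_inf_le (J + K) E n (\<lambda>i. x i + y i) l \<le> D_inf_le J F n x l + D_inf_le K G n y l"
    "D_inf_less (J + K) E n (\<lambda>i. x i + y i) l \<le> D_inf_less J F n x l + D_inf_less K G n y l"
    "D_sup_greater (J + K) E n (\<lambda>i. x i + y i) l \<le> D_sup_greater J F n x l + D_sup_greater K G n y l"
    "D_sup_ge (J + K) E n (\<lambda>i. x i + y i) l \<le> D_sup_ge J F n x l + D_sup_ge K G n y l"
proof -
  interpret E: semideviation_mean "J + K" E n "\<lambda>i. x i + y i" l by (rule semideviation_means[OF xyl])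
  interpret F: semideviation_mean J F n x l by (rule semideviation_means[OF xyl])
  interpret G: semideviation_mean K G n y l by (rule semideviation_means[OF xyl])
  note sign = weighted_sum_sign[OF N xyl]
  show "D_inf_le (J + K) E n (\<lambda>i. x i + y i) l \<le> D_inf_le J F n x l + D_inf_le K G n y l"
    unfolding D_inf_le_def[of J] D_inf_le_def[of K]
    by (rule le_cInf_add[OF F.nonempty(2) G.nonempty(2)]) (auto intro!: E.D_inf_le_least sign(1) set_plus_intro)
  show "D_inf_less (J + K) E n (\<lambda>i. x i + y i) l \<le> D_inf_less J F n x l + D_inf_less K G n y l"
    unfolding D_inf_less_def[of J] D_inf_less_def[of K]
    by (rule le_cInf_add[OF F.nonempty(1) G.nonempty(1)]) (auto intro!: E.D_inf_less_least sign(2) set_plus_intro)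
  show "D_sup_greater (J + K) E n (\<lambda>i. x i + y i) l \<le> D_sup_greater J F n x l + D_sup_greater K G n y l"
    unfolding D_sup_greater_def[of "J + K"]
  proof (rule cSup_least[OF E.nonempty(3)], rule ccontr)
    fix w assume w: "w \<in> {w \<in> J + K. E.e w > 0}" "\<not> w \<le> D_sup_greater J F n x l + D_sup_greater K G n y l"
    then obtain s t where st: "s \<in> J" "t \<in> K" "D_sup_greater J F n x l < s" "D_sup_greater K G n y l < t" "w = s + t"
      using set_plus_split_above[OF J K F.D_mem(3) G.D_mem(3), of w] by auto
    then have "E.e w \<le> 0"
      using sign(1)[OF st(1,2)] F.D_sup_greater_greatest[of s] G.D_sup_greater_greatest[of t] by force
    then show False using w by simp
  qed
  show "D_sup_ge (J + K) E n (\<lambda>i. x i + y i) l \<le> D_sup_ge J F n x l + D_sup_ge K G n y l"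
    unfolding D_sup_ge_def[of "J + K"]
  proof (rule cSup_least[OF E.nonempty(4)], rule ccontr)
    fix w assume w: "w \<in> {w \<in> J + K. E.e w \<ge> 0}" "\<not> w \<le> D_sup_ge J F n x l + D_sup_ge K G n y l"
    then obtain s t where st: "s \<in> J" "t \<in> K" "D_sup_ge J F n x l < s" "D_sup_ge K G n y l < t" "w = s + t"
      using set_plus_split_above[OF J K F.D_mem(4) G.D_mem(4), of w] by auto
    \<comment> \<open>Beyond \<open>D_sup_ge\<close> the sums for \<open>F\<close> and
      \<open>G\<close> are strictly negative, whereas beyond \<open>D_sup_greater\<close> they are
      only nonpositive; hence the other half of \<open>sign\<close> here.\<close>
    then have "E.e w < 0"
      using sign(2)[OF st(1,2)] F.D_sup_ge_greatest[of s] G.D_sup_ge_greatest[of t] by force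
    then show False using w by simp
  qed
qed

text \<open>Replacing the left mean by the smallest one and the right means by the largest ones only
  weakens each of the four inequalities.\<close>

lemma mixed_ineq_if_means_ineq:
  assumes "means_ineq D_inf_le D_inf_le \<or> means_ineq D_inf_less D_inf_less \<or>
    means_ineq D_sup_greater D_sup_greater \<or> means_ineq D_sup_ge D_sup_ge"
  shows "means_ineq D_inf_le D_sup_ge"
proof (intro allI ballI)
  fix n x y l assume xyl: "x \<in> {1..n} \<rightarrow> J" "y \<in> {1..n} \<rightarrow> K" "l \<in> weights n"
  interpret E: semideviation_mean "J + K" E n "\<lambda>i. x i + y i" l by (rule semideviation_means[OF xyl])
  interpret F: semideviation_mean J F n x l by (rule semideviation_means[OF xyl])
  interpret G: semideviation_mean K G n y l by (rule semideviation_means[OF xyl])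
  note means_order =
    E.D_inf_le_le_D_inf_less E.D_inf_le_le_D_sup_greater E.D_sup_greater_le_D_sup_ge
    F.D_inf_le_le_D_inf_less F.D_inf_less_le_D_sup_ge F.D_sup_greater_le_D_sup_ge
    G.D_inf_le_le_D_inf_less G.D_inf_less_le_D_sup_ge G.D_sup_greater_le_D_sup_ge
  from assms have "D_inf_le (J + K) E n (\<lambda>i. x i + y i) l \<le> D_inf_le J F n x l + D_inf_le K G n y l \<or>
    D_inf_less (J + K) E n (\<lambda>i. x i + y i) l \<le> D_inf_less J F n x l + D_inf_less K G n y l \<or>
    D_sup_greater (J + K) E n (\<lambda>i. x i + y i) l \<le> D_sup_greater J F n x l + D_sup_greater K G n y l \<or>
    D_sup_ge (J + K) E n (\<lambda>i. x i + y i) l \<le> D_sup_ge J F n x l + D_sup_ge K G n y l"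
    using xyl by blast
  then show "D_inf_le (J + K) E n (\<lambda>i. x i + y i) l \<le> D_sup_ge J F n x l + D_sup_ge K G n y l"
    using means_order by (elim disjE; linarith)
qed

lemma normalization_ineq_if_mixed_ineq:
  assumes V: "means_ineq D_inf_le D_sup_ge"
  shows "normalization_ineq"
proof (intro ballI)
  fix p u q v assume pu: "p \<in> J" "u \<in> J" and qv: "q \<in> K" "v \<in> K"
  \<comment> \<open>The pairs \<open>(p, u)\<close> and \<open>(q, v)\<close> share the weights
    \<open>(t, 1)\<close>: at \<open>t = 0\<close> only \<open>u\<close> and \<open>v\<close> would
    count, and \<open>t\<close> measures the pull of \<open>p\<close> and \<open>q\<close>.\<close>
  define x y where "x = (\<lambda>i::nat. if i = 1 then p else u)" and "y = (\<lambda>i::nat. if i = 1 then q else v)"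
  define l where "l = (\<lambda>t (i::nat). if i = 1 then t else 1 :: real)"
  have xy: "x \<in> {1..2} \<rightarrow> J" "y \<in> {1..2} \<rightarrow> K" using pu qv by (auto simp: x_def y_def)
  have l: "l t \<in> weights 2" if "0 < t" for t
    using that by (auto simp: weights_def l_def numeral_2_eq_2)
  have ws: "weighted_sum F 2 x (l t) z = t * F p z + F u z"
    "weighted_sum G 2 y (l t) z = t * G q z + G v z"
    "weighted_sum E 2 (\<lambda>i. x i + y i) (l t) z = t * E (p + q) z + E (u + v) z" for t z
    by (simp_all add: weighted_sum_def x_def y_def l_def numeral_2_eq_2)
  \<comment> \<open>Lower mean for \<open>E\<close>, upper means for \<open>F\<close> and
    \<open>G\<close>, as in the mixed inequality; all three are zeros of their weighted sums, so the
    same asymptotics apply.\<close>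
  define DE DF DG where "DE t = D_inf_le (J + K) E 2 (\<lambda>i. x i + y i) (l t)"
    and "DF t = D_sup_ge J F 2 x (l t)" and "DG t = D_sup_ge K G 2 y (l t)" for t
  have D: "DE t \<in> J + K" "t * E (p + q) (DE t) + E (u + v) (DE t) = 0"
    "DF t \<in> J" "t * F p (DF t) + F u (DF t) = 0"
    "DG t \<in> K" "t * G q (DG t) + G v (DG t) = 0" if "0 < t" for t
  proof -
    note means = semideviation_means[OF xy l[OF that]]
    show "DE t \<in> J + K" "DF t \<in> J" "DG t \<in> K"
      unfolding DE_def DF_def DG_def using means by (auto intro: semideviation_mean.D_mem)
    show "t * E (p + q) (DE t) + E (u + v) (DE t) = 0"
      using semideviation_mean.zeros_at_extreme_means(1)[OF means(1) normalizableD(1)[OF JK(1) E(2)]]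
      by (simp add: DE_def ws)
    show "t * F p (DF t) + F u (DF t) = 0"
      using semideviation_mean.zeros_at_extreme_means(2)[OF means(2) normalizableD(1)[OF J(1) F(2)]]
      by (simp add: DF_def ws)
    show "t * G q (DG t) + G v (DG t) = 0"
      using semideviation_mean.zeros_at_extreme_means(2)[OF means(3) normalizableD(1)[OF K(1) G(2)]]
      by (simp add: DG_def ws)
  qed
  have limF: "((\<lambda>t. (DF t - u) / t) \<longlongrightarrow> normalization J F p u) (at_right 0)"
    by (rule perturbed_zero_asymptotics[OF J F pu D(3,4)])
  have limG: "((\<lambda>t. (DG t - v) / t) \<longlongrightarrow> normalization K G q v) (at_right 0)"
    by (rule perturbed_zero_asymptotics[OF K G qv D(5,6)])
  have limE: "((\<lambda>t. (DE t - (u + v)) / t) \<longlongrightarrow> normalization (J + K) E (p + q) (u + v)) (at_right 0)"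
    by (rule perturbed_zero_asymptotics[OF JK E _ _ D(1,2)]) (use pu qv in \<open>auto intro: set_plus_intro\<close>)
  show "normalization (J + K) E (p + q) (u + v) \<le> normalization J F p u + normalization K G q v"
  proof (rule tendsto_le[OF _ tendsto_add[OF limF limG] limE])
    have "\<forall>\<^sub>F t in at_right 0. 0 < (t::real)" by (rule eventually_at_right_less)
    then show "\<forall>\<^sub>F t in at_right 0. (DE t - (u + v)) / t \<le> (DF t - u) / t + (DG t - v) / t"
    proof eventually_elim
      case (elim t)
      have "DE t \<le> DF t + DG t"
        using V xy l[OF elim] by (auto simp: DE_def DF_def DG_def)
      then show ?case using elim by (simp add: add_divide_distrib[symmetric] divide_right_mono)
    qed
  qed simp
qed

lemma means_ineq_iff_normalization_ineq:
  "means_ineq D_inf_le D_inf_le \<longleftrightarrow> normalization_ineq"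
  "means_ineq D_inf_less D_inf_less \<longleftrightarrow> normalization_ineq"
  "means_ineq D_sup_greater D_sup_greater \<longleftrightarrow> normalization_ineq"
  "means_ineq D_sup_ge D_sup_ge \<longleftrightarrow> normalization_ineq"
  "means_ineq D_inf_le D_sup_ge \<longleftrightarrow> normalization_ineq"
proof -
  \<comment> \<open>\<open>normalization_ineq\<close> is the hub: it gives the four unmixed
    inequalities, each of which leads back to it through the mixed one.\<close>
  have *: "means_ineq D_inf_le D_inf_le" "means_ineq D_inf_less D_inf_less"
    "means_ineq D_sup_greater D_sup_greater" "means_ineq D_sup_ge D_sup_ge" if "normalization_ineq"
    by (intro allI ballI means_le_if_normalization_ineq that; assumption)+
  note ** = normalization_ineq_if_mixed_ineq[OF mixed_ineq_if_means_ineq]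
  show "means_ineq D_inf_le D_inf_le \<longleftrightarrow> normalization_ineq"
    by (rule iffI[OF ** *(1)]) simp_all
  show "means_ineq D_inf_less D_inf_less \<longleftrightarrow> normalization_ineq"
    by (rule iffI[OF ** *(2)]) simp_all
  show "means_ineq D_sup_greater D_sup_greater \<longleftrightarrow> normalization_ineq"
    by (rule iffI[OF ** *(3)]) simp_all
  show "means_ineq D_sup_ge D_sup_ge \<longleftrightarrow> normalization_ineq"
    by (rule iffI[OF ** *(4)]) simp_all
  show "means_ineq D_inf_le D_sup_ge \<longleftrightarrow> normalization_ineq"
    by (rule iffI[OF normalization_ineq_if_mixed_ineq mixed_ineq_if_means_ineq[OF disjI1[OF *(1)]]])
qed

end

theorem corollary7p3:
  fixes J K :: "real set" and E F G :: "real \<Rightarrow> real \<Rightarrow> real"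
  assumes "open J" and "is_interval J"
    and "open K" and "is_interval K"
    and "semideviation (J + K) E" and "normalizable (J + K) E"
    and "semideviation J F" and "normalizable J F"
    and "semideviation K G" and "normalizable K G"
  shows
    "let i = (\<forall>n. \<forall>x\<in>{1..n} \<rightarrow> J. \<forall>y\<in>{1..n} \<rightarrow> K. \<forall>l\<in>weights n.
             D_inf_le (J + K) E n (\<lambda>i. x i + y i) l \<le> D_inf_le J F n x l + D_inf_le K G n y l);
         ii = (\<forall>n. \<forall>x\<in>{1..n} \<rightarrow> J. \<forall>y\<in>{1..n} \<rightarrow> K. \<forall>l\<in>weights n.
             D_inf_less (J + K) E n (\<lambda>i. x i + y i) l \<le> D_inf_less J F n x l + D_inf_less K G n y l);
         iii = (\<forall>n. \<forall>x\<in>{1..n} \<rightarrow> J. \<forall>y\<in>{1..n} \<rightarrow> K. \<forall>l\<in>weights n.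
             D_sup_greater (J + K) E n (\<lambda>i. x i + y i) l \<le> D_sup_greater J F n x l + D_sup_greater K G n y l);
         iv = (\<forall>n. \<forall>x\<in>{1..n} \<rightarrow> J. \<forall>y\<in>{1..n} \<rightarrow> K. \<forall>l\<in>weights n.
             D_sup_ge (J + K) E n (\<lambda>i. x i + y i) l \<le> D_sup_ge J F n x l + D_sup_ge K G n y l);
         v = (\<forall>n. \<forall>x\<in>{1..n} \<rightarrow> J. \<forall>y\<in>{1..n} \<rightarrow> K. \<forall>l\<in>weights n.
             D_inf_le (J + K) E n (\<lambda>i. x i + y i) l \<le> D_sup_ge J F n x l + D_sup_ge K G n y l);
         vi = (\<forall>p\<in>J. \<forall>u\<in>J. \<forall>q\<in>K. \<forall>v\<in>K.
             normalization (J + K) E (p + q) (u + v) \<le> normalization J F p u + normalization K G q v)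
     in (i \<longleftrightarrow> ii) \<and> (ii \<longleftrightarrow> iii) \<and> (iii \<longleftrightarrow> iv) \<and> (iv \<longleftrightarrow> v) \<and> (v \<longleftrightarrow> vi)"
proof -
  interpret semideviation_triple J K E F G
    using assms by unfold_locales
  show ?thesis
    \<comment> \<open>Each of the first five assertions is rewritten to the last, which makes the
      chain of equivalences trivial.\<close>
    by (simp only: Let_def means_ineq_iff_normalization_ineq simp_thms)
qed

end
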